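(* The sequence $\left|\frac{B_{2n+2}}{B_{2n}}\right|$ is increasing in $n\in\mathbb{N}$, and, for each fixed $j\in\mathbb{N}$, the sequence $$\frac{(2n+j+3)(2n+j+4)}{(n+2)(2n+3)}\left|\frac{B_{2n+4}}{B_{2n+2}}\right|$$ is increasing in $n\in\mathbb{N}$. Moreover, the inequality $$\left|\frac{B_{2n+2}}{B_{2n}}\right|\ge\frac{(n+1)(2n+1)}{21}$$ holds for all integers $n\ge 2$, and the inequality $$\frac{B_{2n}B_{2n+4}}{B_{2n+2}^2}\ge\frac{(n+2)(2n+3)}{(n+1)(2n+1)}$$ holds for all $n\in\mathbb{N}$.
   Context: $\mathbb{N}=\{1,2,\dotsc\}$. The Bernoulli numbers $B_n$ are defined by the generating function $\frac{z}{e^z-1}=\sum_{n=0}^{\infty}B_n\frac{z^n}{n!}$ for $|z|<2\pi$. *)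

theory Defs
  imports "HOL-Complex_Analysis.Complex_Analysis"
begin

text \<open>
  The Bernoulli numbers, read off the generating function \<open>z / (e\<^sup>z - 1)\<close> as a formal power
  series; in this convention \<open>B\<^sub>1 = -1/2\<close>. The lemma \<open>bernoulli_sums\<close> below shows that
  this is the same as the Taylor expansion on \<open>\<bar>z\<bar> < 2\<pi>\<close>.
\<close>

definition bernoulli :: "nat \<Rightarrow> real" where
  "bernoulli n = fact n * fps_nth (fps_X / (fps_exp 1 - 1)) n"

lemma fps_exp_minus_one_nonzero: "fps_exp 1 - 1 \<noteq> (0 :: 'a :: field_char_0 fps)"
proof
  assume "fps_exp 1 - 1 = (0 :: 'a fps)"
  hence "fps_nth (fps_exp 1 - 1 :: 'a fps) 1 = 0" by (simp only: fps_zero_nth)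
  thus False by simp
qed

lemma subdegree_fps_exp_minus_one: "subdegree (fps_exp 1 - 1 :: 'a :: field_char_0 fps) = 1"
  by (rule subdegreeI) auto

lemma fps_exp_minus_one_dvd_X: "fps_exp 1 - 1 dvd (fps_X :: 'a :: field_char_0 fps)"
proof (subst fps_dvd_iff)
  show "subdegree (fps_exp 1 - 1 :: 'a fps) \<le> subdegree (fps_X :: 'a fps)"
    unfolding subdegree_fps_exp_minus_one by simp
qed (simp_all only: fps_exp_minus_one_nonzero fps_X_neq_zero not_False_eq_True)

lemma bernoulli_egf_complex:
  "Abs_fps (\<lambda>n. complex_of_real (bernoulli n) / fact n) = fps_X / (fps_exp 1 - 1)"
proof -
  define G :: "real fps" where "G = fps_X / (fps_exp 1 - 1)"
  define H where "H = Abs_fps (\<lambda>n. complex_of_real (fps_nth G n))"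
  have "G * (fps_exp 1 - 1) = fps_X"
    unfolding G_def
    by (rule dvd_div_mult_self[OF fps_exp_minus_one_dvd_X])
  hence *: "fps_nth (G * (fps_exp 1 - 1)) n = fps_nth fps_X n" for n
    by simp
  have "fps_nth (H * (fps_exp 1 - 1)) n = fps_nth fps_X n" for n
  proof -
    have "fps_nth (H * (fps_exp 1 - 1)) n = complex_of_real (fps_nth (G * (fps_exp 1 - 1)) n)"
      unfolding fps_mult_nth of_real_sum
      by (intro sum.cong) (auto simp: H_def)
    also have "\<dots> = fps_nth fps_X n"
      unfolding * by (simp add: fps_X_def)
    finally show ?thesis .
  qed
  hence "H * (fps_exp 1 - 1) = fps_X"
    by (simp add: fps_eq_iff)
  hence "H = fps_X / (fps_exp 1 - 1)"
    using nonzero_mult_div_cancel_right[of "fps_exp 1 - 1" H] fps_exp_minus_one_nonzero by simp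
  thus ?thesis
    by (simp add: H_def G_def bernoulli_def)
qed

theorem bernoulli_sums:
  fixes z :: complex
  assumes "norm z < 2 * pi"
  shows "(\<lambda>n. of_real (bernoulli n) * z ^ n / fact n) sums
           (if z = 0 then 1 else z / (exp z - 1))"
proof -
  define f where "f = (\<lambda>z::complex. if z = 0 then 1 else z / (exp z - 1))"
  have F: "f has_fps_expansion (fps_X / (fps_exp 1 - 1))"
    unfolding f_def
  proof (rule has_fps_expansion_divide)
    show "(\<lambda>z::complex. exp z - 1) has_fps_expansion (fps_exp 1 - 1)"
      by (rule has_fps_expansion_diff has_fps_expansion_exp1 has_fps_expansion_1)+
    show "(1 :: complex) = fps_nth fps_X (subdegree (fps_exp 1 - 1 :: complex fps)) /
                fps_nth (fps_exp 1 - 1) (subdegree (fps_exp 1 - 1 :: complex fps))"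
      unfolding subdegree_fps_exp_minus_one by simp
    show "subdegree (fps_exp 1 - 1 :: complex fps) \<le> subdegree (fps_X :: complex fps)"
      unfolding subdegree_fps_exp_minus_one by simp
  qed (rule has_fps_expansion_fps_X fps_exp_minus_one_nonzero)+
  have nz: "exp w \<noteq> 1" if "w \<in> ball 0 (2 * pi) - {0}" for w :: complex
  proof
    assume "exp w = 1"
    then obtain k :: int where k: "Re w = 0" "Im w = of_int (2 * k) * pi"
      by (auto simp: exp_eq_1)
    with that have "k \<noteq> 0" by (auto simp: complex_eq_iff)
    hence "1 \<le> \<bar>real_of_int k\<bar>" by linarith
    hence "2 * pi \<le> \<bar>Im w\<bar>" by (simp add: k abs_mult)
    also have "\<dots> \<le> norm w" by (rule abs_Im_le_cmod)
    finally show False using that by simp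
  qed
  have "isCont f 0" using F by (rule has_fps_expansion_imp_continuous)
  hence lim: "(f \<longlongrightarrow> f w) (at w within ball 0 (2 * pi))" if "w \<in> {0}" for w
    using that by (auto simp: isCont_def intro: tendsto_within_subset[where S = UNIV])
  have "(\<lambda>z. z / (exp z - 1)) holomorphic_on ball 0 (2 * pi) - {0}"
    using nz by (intro holomorphic_intros) auto
  hence "f holomorphic_on ball 0 (2 * pi) - {0}"
    by (rule holomorphic_transform) (auto simp: f_def)
  with lim have hol: "f holomorphic_on ball 0 (2 * pi)"
    by (rule no_isolated_singularity'[where K = "{0}"]) simp_all
  hence "(\<lambda>n. fps_nth (fps_X / (fps_exp 1 - 1)) n * z ^ n) sums f z"
    using assms hol F by (intro has_fps_expansion_imp_sums_complex[where r = "ereal (2 * pi)"]) simp_all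
  thus ?thesis
    by (simp flip: bernoulli_egf_complex add: f_def)
qed

end

theory Submission
  imports Defs
begin

text \<open>
  Everything comes down to Euler's formula
  \<open>\<bar>B\<^bsub>2n\<^esub>\<bar> = 2 (2n)! \<zeta>(2n) / (2\<pi>)\<^bsup>2n\<^esup>\<close> (lemma \<open>bernoulli_even_eq_zeta\<close>), which turns the ratio
  of consecutive Bernoulli numbers into
  \<open>\<bar>B\<^bsub>2n+2\<^esub> / B\<^bsub>2n\<^esub>\<bar> = (n + 1) (2n + 1) q\<^sub>n\<close> with \<open>q\<^sub>n = \<zeta>(2n+2) / (2\<pi>\<^sup>2 \<zeta>(2n))\<close>.
  The polynomial factors are explicit, and every quotient in the claims becomes an explicit
  rational function of \<open>n\<close> times \<open>q\<^sub>n\<close>, \<open>q\<^bsub>n+1\<^esub>\<close> or \<open>q\<^bsub>n+1\<^esub> / q\<^sub>n\<close>. All that is needed is that \<open>q\<^sub>n\<close> is positive and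
  nondecreasing, that is \<open>\<zeta>(2n+2)\<^sup>2 \<le> \<zeta>(2n) \<zeta>(2n+4)\<close>. This is the Cauchy--Schwarz inequality for the
  moments \<open>\<zeta>(2n) = \<Sum>k. k\<^bsup>-2n\<^esup>\<close> (lemma \<open>even_zeta_log_convex\<close>). Strictness in the monotonicity claims
  comes from the polynomial factors. The constant \<open>21\<close> is the value of \<open>1 / q\<^sub>2\<close>, as given by
  \<open>B\<^sub>4 = -1/30\<close> and \<open>B\<^sub>6 = 1/42\<close>, so equality holds there for \<open>n = 2\<close>.

  Euler's formula is obtained by expanding \<open>\<pi>x cot (\<pi>x)\<close> into powers of \<open>x\<close> in two ways. Putting
  \<open>z = 2\<pi>ix\<close> into the generating function of the Bernoulli numbers and taking real parts gives one
  expansion. The partial fraction decomposition of the cotangent, with each fraction expanded as a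
  geometric series and the double sum rearranged, gives the other one, with the zeta values as
  coefficients. The partial fractions themselves are the logarithmic derivative of the reflection
  formula for the Gamma function, read through the series for the Digamma function.
\<close>

section \<open>Partial fractions of the cotangent\<close>

text \<open>This is the logarithmic derivative of \<open>\<Gamma>(z) \<Gamma>(1 - z) = \<pi> / sin (\<pi>z)\<close>.\<close>

lemma Digamma_reflection_complex:
  fixes z :: complex
  assumes "z \<notin> \<int>"
  shows "Digamma (1 - z) - Digamma z = of_real pi * cot (of_real pi * z)"
proof -
  have s: "sin (of_real pi * z) \<noteq> 0"
    using assms by (auto simp: sin_eq_0 mult.commute)
  have z: "z \<notin> \<int>\<^sub>\<le>\<^sub>0" "1 - z \<notin> \<int>\<^sub>\<le>\<^sub>0"
    using assms nonpos_Ints_Int Ints_diff[of 1 "1 - z"] by auto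
  have "((\<lambda>z. Gamma z * Gamma (1 - z)) has_field_derivative
          Gamma z * Gamma (1 - z) * (Digamma z - Digamma (1 - z))) (at z)"
    using z by (auto intro!: derivative_eq_intros simp: algebra_simps)
  hence "((\<lambda>z. of_real pi / sin (of_real pi * z)) has_field_derivative
          of_real pi / sin (of_real pi * z) * (Digamma z - Digamma (1 - z))) (at z)"
    by (simp only: Gamma_reflection_complex)
  moreover have "((\<lambda>z. of_real pi / sin (of_real pi * z)) has_field_derivative
          of_real pi / sin (of_real pi * z) * (- of_real pi * cot (of_real pi * z))) (at z)"
    using s by (auto intro!: derivative_eq_intros simp: cot_def field_simps)
  ultimately have "of_real pi / sin (of_real pi * z) * (Digamma z - Digamma (1 - z)) =
      of_real pi / sin (of_real pi * z) * (- of_real pi * cot (of_real pi * z))"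
    by (rule DERIV_unique)
  hence "Digamma z - Digamma (1 - z) = - of_real pi * cot (of_real pi * z)"
    using s by (subst (asm) mult_cancel_left) simp
  thus ?thesis by (simp add: algebra_simps)
qed

text \<open>
  In the series of \<open>\<psi>(1 + z) - \<psi>(1 - z)\<close> the harmonic terms cancel and the remaining pairs combine
  to the fractions below. The pole of the cotangent at \<open>0\<close> corresponds to the term \<open>1/z\<close> in
  \<open>\<psi>(1 + z) = \<psi>(z) + 1/z\<close>.
\<close>

lemma cot_partial_fractions:
  fixes z :: complex
  assumes "z \<notin> \<int>"
  shows "(\<lambda>k. 2 * z\<^sup>2 / (of_nat (Suc k) ^ 2 - z\<^sup>2)) sums
           (1 - of_real pi * z * cot (of_real pi * z))"
proof -
  have nz: "z \<noteq> 0" "1 + z \<noteq> 0" "1 - z \<noteq> 0"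
    using assms Ints_minus[of 1] by (auto simp: add_eq_0_iff)
  have nz': "of_nat (Suc k) + z \<noteq> 0" "of_nat (Suc k) - z \<noteq> 0" for k
    using assms Ints_minus[of "of_nat (Suc k)"] Ints_of_nat[of "Suc k"]
    by (auto simp: add_eq_0_iff simp del: of_nat_Suc)
  have D: "(\<lambda>k. inverse (of_nat (Suc k)) - inverse (w + of_nat k)) sums
             (Digamma w + euler_mascheroni)" if "w \<noteq> 0" for w :: complex
    using summable_Digamma[OF that] by (simp add: Digamma_def summable_sums)
  have "(\<lambda>k. z * ((inverse (of_nat (Suc k)) - inverse (1 + z + of_nat k)) -
               (inverse (of_nat (Suc k)) - inverse (1 - z + of_nat k)))) sums
          (z * ((Digamma (1 + z) + euler_mascheroni) - (Digamma (1 - z) + euler_mascheroni)))"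
    by (intro sums_mult sums_diff D nz)
  also have "(\<lambda>k. z * ((inverse (of_nat (Suc k)) - inverse (1 + z + of_nat k)) -
               (inverse (of_nat (Suc k)) - inverse (1 - z + of_nat k)))) =
             (\<lambda>k. 2 * z\<^sup>2 / (of_nat (Suc k) ^ 2 - z\<^sup>2))"
  proof
    fix k :: nat
    define w :: complex where "w = of_nat (Suc k)"
    have w: "1 + z + of_nat k = w + z" "1 - z + of_nat k = w - z" "w + z \<noteq> 0" "w - z \<noteq> 0"
      using nz'[of k] by (simp_all add: w_def algebra_simps)
    have "w\<^sup>2 - z\<^sup>2 = (w + z) * (w - z)"
      by (simp add: power2_eq_square algebra_simps)
    hence "z * (inverse (w - z) - inverse (w + z)) = 2 * z\<^sup>2 / (w\<^sup>2 - z\<^sup>2)"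
      using w(3,4) by (simp add: field_simps power2_eq_square)
    thus "z * ((inverse (of_nat (Suc k)) - inverse (1 + z + of_nat k)) -
               (inverse (of_nat (Suc k)) - inverse (1 - z + of_nat k))) =
          2 * z\<^sup>2 / (of_nat (Suc k) ^ 2 - z\<^sup>2)"
      unfolding w(1,2) w_def [symmetric] by (simp add: algebra_simps)
  qed
  also have "Digamma (1 + z) = Digamma z + 1 / z"
    using Digamma_plus1[OF nz(1)] by (simp add: add.commute)
  also have "z * (Digamma z + 1 / z + euler_mascheroni - (Digamma (1 - z) + euler_mascheroni)) =
             1 - z * (Digamma (1 - z) - Digamma z)"
    using nz(1) by (simp add: algebra_simps)
  also have "\<dots> = 1 - of_real pi * z * cot (of_real pi * z)"
    by (simp add: Digamma_reflection_complex[OF assms])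
  finally show ?thesis .
qed

lemma cot_partial_fractions_real:
  fixes x :: real
  assumes "x \<noteq> 0" "\<bar>x\<bar> < 1"
  shows "(\<lambda>k. 2 * x\<^sup>2 / (of_nat (Suc k) ^ 2 - x\<^sup>2)) sums (1 - pi * x * cot (pi * x))"
proof -
  have "complex_of_real x \<notin> \<int>"
    using assms by (auto elim!: Ints_cases simp: complex_eq_iff)
  from cot_partial_fractions[OF this]
  have "(\<lambda>k. complex_of_real (2 * x\<^sup>2 / (of_nat (Suc k) ^ 2 - x\<^sup>2))) sums
          complex_of_real (1 - pi * x * cot (pi * x))"
    by (simp add: cot_of_real)
  thus ?thesis by (simp only: sums_of_real_iff)
qed

section \<open>Zeta values at even integers\<close>

definition even_zeta :: "nat \<Rightarrow> real" where
  "even_zeta m = (\<Sum>k. 1 / real (Suc k) ^ (2 * m))"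

lemma even_zeta_sums:
  assumes "m \<ge> 1"
  shows "(\<lambda>k. 1 / real (Suc k) ^ (2 * m)) sums even_zeta m"
proof -
  have "summable (\<lambda>k. inverse (real k ^ (2 * m)))"
    using inverse_power_summable[of "2 * m", where ?'a = real] assms by simp
  hence "summable (\<lambda>k. 1 / real (Suc k) ^ (2 * m))"
    by (subst (asm) summable_Suc_iff [symmetric]) (simp add: inverse_eq_divide)
  thus ?thesis by (simp add: even_zeta_def summable_sums)
qed

lemma even_zeta_pos:
  assumes "m \<ge> 1"
  shows "even_zeta m > 0"
  unfolding even_zeta_def
  by (rule suminf_pos) (use even_zeta_sums[OF assms] in \<open>auto simp: sums_iff\<close>)

text \<open>
  For every real \<open>t\<close> the quadratic \<open>t\<^sup>2 \<zeta>(2m) - 2t \<zeta>(2m+2) + \<zeta>(2m+4)\<close> is the sum of the nonnegative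
  terms \<open>k\<^bsup>-2m\<^esup> (t - k\<^bsup>-2\<^esup>)\<^sup>2\<close>. Its value at the minimiser \<open>t = \<zeta>(2m+2) / \<zeta>(2m)\<close> gives the inequality.
\<close>

lemma even_zeta_log_convex:
  assumes "m \<ge> 1"
  shows "even_zeta (m + 1) ^ 2 \<le> even_zeta m * even_zeta (m + 2)"
proof -
  define a b c where "a = even_zeta m" and "b = even_zeta (m + 1)" and "c = even_zeta (m + 2)"
  have "a > 0" unfolding a_def using assms by (rule even_zeta_pos)
  define t where "t = b / a"
  have "(\<lambda>k. t\<^sup>2 * (1 / real (Suc k) ^ (2 * m)) - 2 * t * (1 / real (Suc k) ^ (2 * (m + 1)))
          + 1 / real (Suc k) ^ (2 * (m + 2))) sums (t\<^sup>2 * a - 2 * t * b + c)"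
    unfolding a_def b_def c_def
    by (intro sums_add sums_diff sums_mult even_zeta_sums) (use assms in auto)
  moreover have "t\<^sup>2 * (1 / real (Suc k) ^ (2 * m)) - 2 * t * (1 / real (Suc k) ^ (2 * (m + 1)))
          + 1 / real (Suc k) ^ (2 * (m + 2)) =
        (1 / real (Suc k) ^ (2 * m)) * (t - 1 / real (Suc k) ^ 2) ^ 2" for k
    by (simp add: power_add power2_diff field_simps power2_eq_square power4_eq_xxxx del: of_nat_Suc)
  hence "0 \<le> t\<^sup>2 * (1 / real (Suc k) ^ (2 * m)) - 2 * t * (1 / real (Suc k) ^ (2 * (m + 1)))
          + 1 / real (Suc k) ^ (2 * (m + 2))" for k
    by (simp del: of_nat_Suc)
  ultimately have "0 \<le> t\<^sup>2 * a - 2 * t * b + c"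
    by (rule sums_le[OF _ sums_zero, rotated])
  also have "t\<^sup>2 * a - 2 * t * b + c = c - b\<^sup>2 / a"
    using \<open>a > 0\<close> by (simp add: t_def field_simps power2_eq_square)
  finally show ?thesis
    using \<open>a > 0\<close> by (simp add: a_def b_def c_def field_simps)
qed

section \<open>Two power series for the cotangent\<close>

text \<open>
  For real \<open>x\<close> the double series obtained by expanding the partial fractions has nonnegative terms,
  so it can be summed by columns instead of rows. The \<open>k\<close>-th row is the geometric series of a partial
  fraction, and the \<open>m\<close>-th column is a multiple of a zeta value.
\<close>

lemma cot_even_zeta_expansion:
  fixes x :: real
  assumes "\<bar>x\<bar> < 1" "x \<noteq> 0"
  shows "(\<lambda>m. 2 * even_zeta (Suc m) * x ^ (2 * Suc m)) sums (1 - pi * x * cot (pi * x))"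
proof -
  define F where "F = (\<lambda>(k::nat, m::nat). 2 * (x\<^sup>2 / real (Suc k) ^ 2) ^ Suc m)"
  have F_nonneg: "F p \<ge> 0" for p
    by (cases p) (simp add: F_def)
  have row: "((\<lambda>m. F (k, m)) has_sum (2 * x\<^sup>2 / (real (Suc k) ^ 2 - x\<^sup>2))) UNIV" for k
  proof (rule sums_nonneg_imp_has_sum)
    define q where "q = x\<^sup>2 / real (Suc k) ^ 2"
    have x2: "x\<^sup>2 < 1" using assms(1) by (simp add: abs_square_less_1)
    have k2: "1 \<le> real (Suc k) ^ 2" by (rule one_le_power) simp
    have "x\<^sup>2 < real (Suc k) ^ 2" using x2 k2 by linarith
    hence "0 \<le> q" "q < 1" using k2 by (simp_all add: q_def del: of_nat_Suc)
    hence "(\<lambda>m. 2 * q * q ^ m) sums (2 * q * (1 / (1 - q)))"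
      by (intro sums_mult geometric_sums) auto
    also have "2 * q * (1 / (1 - q)) = 2 * x\<^sup>2 / (real (Suc k) ^ 2 - x\<^sup>2)"
    proof -
      have "real (Suc k) ^ 2 \<noteq> 0" "real (Suc k) ^ 2 - x\<^sup>2 \<noteq> 0"
        using x2 k2 by linarith+
      thus ?thesis by (simp add: q_def field_simps del: of_nat_Suc)
    qed
    finally show "(\<lambda>m. F (k, m)) sums (2 * x\<^sup>2 / (real (Suc k) ^ 2 - x\<^sup>2))"
      by (simp add: F_def q_def mult.assoc)
  qed (rule F_nonneg)
  have nn: "0 \<le> 2 * x\<^sup>2 / (real (Suc k) ^ 2 - x\<^sup>2)" for k
    using row[of k] F_nonneg by (rule has_sum_nonneg)
  have rows: "((\<lambda>k. 2 * x\<^sup>2 / (real (Suc k) ^ 2 - x\<^sup>2)) has_sum (1 - pi * x * cot (pi * x))) UNIV"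
    by (rule sums_nonneg_imp_has_sum[OF cot_partial_fractions_real[OF assms(2,1)] nn])
  have "F summable_on UNIV \<times> UNIV"
  proof (rule summable_on_SigmaI)
    show "((\<lambda>m. F (k, m)) has_sum (2 * x\<^sup>2 / (real (Suc k) ^ 2 - x\<^sup>2))) UNIV" for k by (rule row)
    show "(\<lambda>k. 2 * x\<^sup>2 / (real (Suc k) ^ 2 - x\<^sup>2)) summable_on UNIV"
      using rows by (rule has_sum_imp_summable)
  qed (use F_nonneg in auto)
  hence "(F has_sum (1 - pi * x * cot (pi * x))) (UNIV \<times> UNIV)"
    by (intro has_sum_SigmaI[OF row rows])
  hence "((\<lambda>(m, k). F (k, m)) has_sum (1 - pi * x * cot (pi * x))) (UNIV \<times> UNIV)"
    by (subst has_sum_swap) simp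
  hence "((\<lambda>m. 2 * even_zeta (Suc m) * x ^ (2 * Suc m)) has_sum (1 - pi * x * cot (pi * x))) UNIV"
  proof (rule has_sum_SigmaD)
    fix m :: nat
    have "(\<lambda>k. 2 * x ^ (2 * Suc m) * (1 / real (Suc k) ^ (2 * Suc m))) sums
            (2 * x ^ (2 * Suc m) * even_zeta (Suc m))"
      by (intro sums_mult even_zeta_sums) simp
    also have "(\<lambda>k. 2 * x ^ (2 * Suc m) * (1 / real (Suc k) ^ (2 * Suc m))) = (\<lambda>k. F (k, m))"
      by (simp only: F_def prod.case power_divide power_mult times_divide_eq_right mult_1_right
            times_divide_eq_left)
    finally show "((\<lambda>k. case (m, k) of (m, k) \<Rightarrow> F (k, m)) has_sum
                    (2 * even_zeta (Suc m) * x ^ (2 * Suc m))) UNIV"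
      by (simp add: sums_nonneg_imp_has_sum F_nonneg mult_ac)
  qed
  thus ?thesis by (rule has_sum_imp_sums)
qed

text \<open>
  These are the coefficients of \<open>X\<^bsup>n+1\<^esup>\<close> in \<open>(X / (e\<^sup>X - 1)) (e\<^sup>X - 1) = X\<close>.
\<close>

lemma bernoulli_recurrence:
  "(\<Sum>i=0..n. bernoulli i / (fact i * fact (Suc n - i))) = (if n = 0 then 1 else 0)"
proof -
  define G :: "real fps" where "G = fps_X / (fps_exp 1 - 1)"
  have nth: "fps_nth G i = bernoulli i / fact i" for i
    by (simp add: G_def bernoulli_def)
  have "G * (fps_exp 1 - 1) = fps_X"
    unfolding G_def by (rule dvd_div_mult_self[OF fps_exp_minus_one_dvd_X])
  hence "fps_nth (G * (fps_exp 1 - 1)) (Suc n) = (if n = 0 then 1 else 0)"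
    by (simp add: fps_X_def)
  also have "fps_nth (G * (fps_exp 1 - 1)) (Suc n) =
      (\<Sum>i=0..n. bernoulli i / fact i * (1 / fact (Suc n - i)))"
    by (simp add: fps_mult_nth nth mult.commute)
  finally show ?thesis
    by (simp only: times_divide_eq_right mult_1_right divide_divide_eq_left)
qed

text \<open>
  With \<open>z = 2it\<close> one has \<open>z / (e\<^sup>z - 1) = (t / sin t) e\<^bsup>-it\<^esup>\<close>, whose real part is \<open>t cot t\<close>. The factor
  \<open>Re (\<i>\<^sup>n)\<close> makes the terms of odd index vanish.
\<close>

lemma cot_bernoulli_expansion:
  fixes x :: real
  assumes "\<bar>x\<bar> < 1" "x \<noteq> 0"
  shows "(\<lambda>n. bernoulli n / fact n * (2 * pi) ^ n * Re (\<i> ^ n) * x ^ n) sums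
           (pi * x * cot (pi * x))"
proof -
  define t where "t = pi * x"
  define z :: complex where "z = 2 * t * \<i>"
  have s: "sin t \<noteq> 0"
    using assms sin_zero_iff_int2[of t] by (auto simp: t_def)
  have "z \<noteq> 0" using assms by (simp add: z_def t_def)
  have "exp z - 1 = cis (2 * t) - 1"
    by (simp add: cis_conv_exp z_def mult_ac)
  also have "\<dots> = 2 * \<i> * sin t * cis t"
    by (simp add: complex_eq_iff cos_double_sin sin_double power2_eq_square)
  finally have e: "exp z - 1 = 2 * \<i> * sin t * cis t" .
  have "z / (exp z - 1) = of_real (t / sin t) * cis (- t)"
    unfolding e using s by (simp add: z_def field_simps cis_mult flip: cis_inverse)
  hence "Re (z / (exp z - 1)) = t * cot t"
    by (simp add: cot_def)
  moreover have "norm z < 2 * pi"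
    using assms by (simp add: z_def t_def norm_mult abs_mult)
  ultimately have "(\<lambda>n. Re (of_real (bernoulli n) * z ^ n / fact n)) sums (t * cot t)"
    using sums_Re[OF bernoulli_sums[of z]] \<open>z \<noteq> 0\<close> by simp
  also have "(\<lambda>n. Re (of_real (bernoulli n) * z ^ n / fact n)) =
             (\<lambda>n. bernoulli n / fact n * (2 * pi) ^ n * Re (\<i> ^ n) * x ^ n)"
  proof
    fix n
    have "of_real (bernoulli n) * z ^ n / fact n =
            of_real (bernoulli n / fact n * (2 * pi) ^ n * x ^ n) * \<i> ^ n"
      by (simp add: z_def t_def power_mult_distrib)
    thus "Re (of_real (bernoulli n) * z ^ n / fact n) =
            bernoulli n / fact n * (2 * pi) ^ n * Re (\<i> ^ n) * x ^ n"
      by (simp del: of_real_mult of_real_divide)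
  qed
  finally show ?thesis by (simp add: t_def mult.assoc)
qed

section \<open>Euler's formula and its consequences\<close>

text \<open>
  The two expansions of \<open>\<pi>x cot (\<pi>x)\<close> hold for \<open>0 < \<bar>x\<bar> < 1\<close>, so their coefficients agree.
\<close>

theorem bernoulli_even_eq_zeta:
  assumes "m \<ge> 1"
  shows "bernoulli (2 * m) = (-1) ^ (m + 1) * 2 * fact (2 * m) * even_zeta m / (2 * pi) ^ (2 * m)"
proof -
  \<comment> \<open>\<open>a\<close> are the coefficients of \<open>\<pi>x cot (\<pi>x)\<close>, and \<open>b\<close> those of \<open>1 - \<pi>x cot (\<pi>x)\<close>, padded with
    zeros at the odd powers; hence \<open>d\<close> should vanish identically.\<close>
  define a where "a = (\<lambda>n. bernoulli n / fact n * (2 * pi) ^ n * Re (\<i> ^ n))"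
  define b where "b = (\<lambda>n. if even n \<and> n > 0 then 2 * even_zeta (n div 2) else 0)"
  define d where "d = (\<lambda>n. a n + b n - (if n = 0 then 1 else 0))"
  have d0: "d 0 = 0"
    using bernoulli_recurrence[of 0] by (simp add: d_def a_def b_def)
  have "(\<lambda>n. d n * x ^ n) sums 0" if x: "\<bar>x\<bar> < 1" for x :: real
  proof (cases "x = 0")
    case True
    thus ?thesis using powser_sums_zero[of d] d0 by simp
  next
    case False
    have "(\<lambda>m. b (2 * Suc m) * x ^ (2 * Suc m)) sums (1 - pi * x * cot (pi * x))"
      using cot_even_zeta_expansion[OF x False] by (simp add: b_def)
    also have "?this \<longleftrightarrow> (\<lambda>n. b n * x ^ n) sums (1 - pi * x * cot (pi * x))"
    proof (rule sums_mono_reindex)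
      show "strict_mono (\<lambda>m. 2 * Suc m)" by (rule strict_monoI) simp
      fix n :: nat assume n: "n \<notin> range (\<lambda>m. 2 * Suc m)"
      have "\<not> (even n \<and> n > 0)"
      proof
        assume "even n \<and> n > 0"
        hence "n = 2 * Suc (n div 2 - 1)" by (auto elim!: evenE)
        thus False using n by blast
      qed
      thus "b n * x ^ n = 0" unfolding b_def by (simp only: if_False mult_zero_left)
    qed
    finally have "(\<lambda>n. a n * x ^ n + b n * x ^ n - (if n = 0 then 1 else 0) * x ^ n) sums
        (pi * x * cot (pi * x) + (1 - pi * x * cot (pi * x)) - x ^ 0)"
      using cot_bernoulli_expansion[OF x False] unfolding a_def
      by (intro sums_add sums_diff powser_sums_if) auto
    thus ?thesis by (simp add: d_def algebra_simps)
  qed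
  hence sums: "\<And>x::real. norm (x - 0) < 1 \<Longrightarrow> (\<lambda>n. d n * (x - 0) ^ n) sums 0"
    by simp
  have "d (2 * m) = 0"
  proof (rule ccontr)
    assume "d (2 * m) \<noteq> 0"
    \<comment> \<open>Nonzero power series have isolated zeros, so the zero function would be nonzero near \<open>0\<close>.\<close>
    then obtain s :: real where "s > 0" and "\<And>x::real. x \<in> cball 0 s - {0} \<Longrightarrow> (0 :: real) \<noteq> 0"
      using powser_0_nonzero[of 1 0 d "\<lambda>_. 0" "2 * m"] sums assms by auto
    from this(2)[of s] \<open>s > 0\<close> show False by simp
  qed
  moreover have "Re (\<i> ^ (2 * m)) = (-1) ^ m"
    by (simp add: power_mult flip: of_real_power)
  ultimately have "bernoulli (2 * m) / fact (2 * m) * (2 * pi) ^ (2 * m) * (-1) ^ m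
      = - 2 * even_zeta m"
    using assms by (simp add: d_def a_def b_def)
  hence "(-1) ^ m * (bernoulli (2 * m) / fact (2 * m) * (2 * pi) ^ (2 * m) * (-1) ^ m)
      = (-1) ^ m * (- 2 * even_zeta m)"
    by (rule arg_cong)
  hence "bernoulli (2 * m) / fact (2 * m) * (2 * pi) ^ (2 * m) = (-1) ^ m * (- 2 * even_zeta m)"
    by (simp add: mult_ac flip: power_add)
  thus ?thesis by (simp add: field_simps)
qed

lemma bernoulli_ratio:
  assumes "n \<ge> 1"
  shows "\<bar>bernoulli (2 * n + 2) / bernoulli (2 * n)\<bar> =
           (real n + 1) * (2 * real n + 1) * (even_zeta (n + 1) / even_zeta n / (2 * pi\<^sup>2))"
proof -
  have "bernoulli (2 * n + 2) = bernoulli (2 * (n + 1))" by simp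
  also have "\<bar>\<dots>\<bar> = 2 * fact (2 * (n + 1)) * even_zeta (n + 1) / (2 * pi) ^ (2 * (n + 1))"
    using even_zeta_pos[of "n + 1"]
    by (subst bernoulli_even_eq_zeta) (simp_all add: abs_mult power_abs)
  finally have 1: "\<bar>bernoulli (2 * n + 2)\<bar> =
      2 * ((2 * real n + 2) * (2 * real n + 1) * fact (2 * n)) * even_zeta (n + 1) /
        ((2 * pi)\<^sup>2 * (2 * pi) ^ (2 * n))"
    by (simp add: power2_eq_square algebra_simps)
  have 2: "\<bar>bernoulli (2 * n)\<bar> = 2 * fact (2 * n) * even_zeta n / (2 * pi) ^ (2 * n)"
    using even_zeta_pos[OF assms]
    by (subst bernoulli_even_eq_zeta[OF assms]) (simp_all add: abs_mult power_abs)
  show ?thesis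
    unfolding abs_divide 1 2 using even_zeta_pos[OF assms]
    by (simp add: field_simps power2_eq_square)
qed

text \<open>A log-convex sequence of positive numbers has nondecreasing consecutive ratios.\<close>

lemma mono_even_zeta_ratio:
  assumes "1 \<le> m" "m \<le> n"
  shows "even_zeta (m + 1) / even_zeta m \<le> even_zeta (n + 1) / even_zeta n"
  using assms(2)
proof (induction n rule: dec_induct)
  case (step n)
  have "even_zeta (n + 1) / even_zeta n \<le> even_zeta (n + 2) / even_zeta (n + 1)"
    using even_zeta_log_convex[of n] even_zeta_pos[of n] even_zeta_pos[of "n + 1"] assms(1) step(1)
    by (simp add: field_simps power2_eq_square)
  with step.IH show ?case by simp
qed simp

lemma bernoulli_values:
  "bernoulli 4 = - 1 / 30" "bernoulli 6 = 1 / 42"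
proof -
  note R = bernoulli_recurrence
  note [simp] = atLeast0_atMost_Suc fact_numeral numeral_eq_Suc
  have B0: "bernoulli 0 = 1" using R[of 0] by simp
  have B1: "bernoulli 1 = - 1 / 2" using R[of 1] B0 by simp
  have B2: "bernoulli 2 = 1 / 6" using R[of 2] B0 B1 by simp
  have B3: "bernoulli 3 = 0" using R[of 3] B0 B1 B2 by simp
  have B4: "bernoulli 4 = - 1 / 30" using R[of 4] B0 B1 B2 B3 by simp
  have B5: "bernoulli 5 = 0" using R[of 5] B0 B1 B2 B3 B4 by simp
  have B6: "bernoulli 6 = 1 / 42" using R[of 6] B0 B1 B2 B3 B4 B5 by simp
  show "bernoulli 4 = - 1 / 30" "bernoulli 6 = 1 / 42" by fact+
qed

theorem theorem4p1:
  shows "strict_mono_on {1::nat..} (\<lambda>n. \<bar>bernoulli (2*n+2) / bernoulli (2*n)\<bar>)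
    \<and> (\<forall>j::nat. j \<ge> 1 \<longrightarrow>
         strict_mono_on {1::nat..}
           (\<lambda>n. (2 * real n + real j + 3) * (2 * real n + real j + 4)
                  / ((real n + 2) * (2 * real n + 3))
                  * \<bar>bernoulli (2*n+4) / bernoulli (2*n+2)\<bar>))
    \<and> (\<forall>n::nat. n \<ge> 2 \<longrightarrow>
         \<bar>bernoulli (2*n+2) / bernoulli (2*n)\<bar> \<ge> (real n + 1) * (2 * real n + 1) / 21)
    \<and> (\<forall>n::nat. n \<ge> 1 \<longrightarrow>
         bernoulli (2*n) * bernoulli (2*n+4) / (bernoulli (2*n+2))\<^sup>2
           \<ge> ((real n + 2) * (2 * real n + 3)) / ((real n + 1) * (2 * real n + 1)))"
proof (intro conjI allI impI strict_mono_onI)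
  define q where "q = (\<lambda>n. even_zeta (n + 1) / even_zeta n / (2 * pi\<^sup>2))"
  have q_pos: "q n > 0" if "n \<ge> 1" for n
    using that even_zeta_pos[of n] even_zeta_pos[of "n + 1"] by (simp add: q_def)
  have q_mono: "q m \<le> q n" if "1 \<le> m" "m \<le> n" for m n
    unfolding q_def by (intro divide_right_mono mono_even_zeta_ratio that) simp
  have ratio: "\<bar>bernoulli (2 * n + 2) / bernoulli (2 * n)\<bar> = (real n + 1) * (2 * real n + 1) * q n"
    if "n \<ge> 1" for n
    unfolding q_def by (rule bernoulli_ratio[OF that])
  have ratio': "\<bar>bernoulli (2 * n + 4) / bernoulli (2 * n + 2)\<bar> =
      (real n + 2) * (2 * real n + 3) * q (n + 1)" for n
  proof -
    have "2 * (n + 1) + 2 = 2 * n + 4" "2 * (n + 1) = 2 * n + 2"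
         "real (n + 1) + 1 = real n + 2" "2 * real (n + 1) + 1 = 2 * real n + 3"
      by simp_all
    with ratio[OF le_add2[of 1 n]] show ?thesis by (simp only:)
  qed

  show "\<bar>bernoulli (2 * m + 2) / bernoulli (2 * m)\<bar> < \<bar>bernoulli (2 * n + 2) / bernoulli (2 * n)\<bar>"
    if "m \<in> {1..}" "n \<in> {1..}" "m < n" for m n :: nat
  proof -
    have "(real m + 1) * (2 * real m + 1) * q m < (real n + 1) * (2 * real n + 1) * q n"
      using that q_mono[of m n] q_pos[of m] by (intro mult_less_le_imp_less mult_strict_mono) auto
    thus ?thesis using that ratio[of m] ratio[of n] by simp
  qed

  show "(2 * real m + real j + 3) * (2 * real m + real j + 4) / ((real m + 2) * (2 * real m + 3))
          * \<bar>bernoulli (2 * m + 4) / bernoulli (2 * m + 2)\<bar>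
      < (2 * real n + real j + 3) * (2 * real n + real j + 4) / ((real n + 2) * (2 * real n + 3))
          * \<bar>bernoulli (2 * n + 4) / bernoulli (2 * n + 2)\<bar>"
    if "m \<in> {1..}" "n \<in> {1..}" "m < n" for m n j :: nat
  proof -
    have "(2 * real k + real j + 3) * (2 * real k + real j + 4) / ((real k + 2) * (2 * real k + 3))
          * \<bar>bernoulli (2 * k + 4) / bernoulli (2 * k + 2)\<bar>
        = (2 * real k + real j + 3) * (2 * real k + real j + 4) * q (k + 1)" for k
    proof -
      have "(real k + 2) * (2 * real k + 3) \<noteq> 0" by auto
      thus ?thesis unfolding ratio' by (simp del: mult_eq_0_iff)
    qed
    moreover have "(2 * real m + real j + 3) * (2 * real m + real j + 4) * q (m + 1)
        < (2 * real n + real j + 3) * (2 * real n + real j + 4) * q (n + 1)"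
      using that q_mono[of "m + 1" "n + 1"] q_pos[of "m + 1"]
      by (intro mult_less_le_imp_less mult_strict_mono) auto
    ultimately show ?thesis by simp
  qed

  show "\<bar>bernoulli (2 * n + 2) / bernoulli (2 * n)\<bar> \<ge> (real n + 1) * (2 * real n + 1) / 21"
    if "n \<ge> 2" for n
  proof -
    have "q 2 = 1 / 21"
      using ratio[of 2] by (simp add: bernoulli_values)
    hence "1 / 21 \<le> q n" using q_mono[of 2 n] that by simp
    hence "(real n + 1) * (2 * real n + 1) * (1 / 21) \<le> (real n + 1) * (2 * real n + 1) * q n"
      by (intro mult_left_mono) auto
    thus ?thesis using ratio[of n] that by simp
  qed

  show "bernoulli (2 * n) * bernoulli (2 * n + 4) / (bernoulli (2 * n + 2))\<^sup>2
          \<ge> (real n + 2) * (2 * real n + 3) / ((real n + 1) * (2 * real n + 1))"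
    if "n \<ge> 1" for n
  proof -
    \<comment> \<open>The signs of the even-indexed Bernoulli numbers alternate, so an index shift by \<open>4\<close> preserves
      the sign and the quotient equals a quotient of two absolute ratios.\<close>
    have "bernoulli (2 * n) * bernoulli (2 * (n + 2)) \<ge> 0"
      using that even_zeta_pos[of n] even_zeta_pos[of "n + 2"]
      by (subst (1 2) bernoulli_even_eq_zeta) (auto simp: zero_le_mult_iff zero_le_divide_iff)
    moreover have eq: "2 * (n + 2) = 2 * n + 4" by simp
    ultimately have "bernoulli (2 * n) * bernoulli (2 * n + 4) = \<bar>bernoulli (2 * n)\<bar> * \<bar>bernoulli (2 * n + 4)\<bar>"
      by (simp only: abs_of_nonneg eq flip: abs_mult)
    hence "bernoulli (2 * n) * bernoulli (2 * n + 4) / (bernoulli (2 * n + 2))\<^sup>2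
        = \<bar>bernoulli (2 * n + 4) / bernoulli (2 * n + 2)\<bar> /
          \<bar>bernoulli (2 * n + 2) / bernoulli (2 * n)\<bar>"
      by (simp add: power2_eq_square abs_mult)
    also have "\<dots> = (real n + 2) * (2 * real n + 3) / ((real n + 1) * (2 * real n + 1))
        * (q (n + 1) / q n)"
      unfolding ratio' ratio[OF that] by simp
    also have "\<dots> \<ge> (real n + 2) * (2 * real n + 3) / ((real n + 1) * (2 * real n + 1)) * 1"
      using q_mono[of n "n + 1"] q_pos[OF that] that by (intro mult_left_mono) auto
    finally show ?thesis by simp
  qed
qed

end
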